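(* Let $d\geq 0$ be an integer and let $P_2^d:=\operatorname{conv}\mathcal{D}_d(\mathbb{N}^2)\subset\mathbb{R}^2$ be the two-dimensional corner cut polyhedron. Then every lattice point of $P_2^d$ can be written as a sum of $d$ distinct lattice points in $\mathbb{N}^2$; that is, $P_2^d\cap\mathbb{Z}^2\subseteq\mathcal{D}_d(\mathbb{N}^2)$.
   Context: $\mathbb{N}=\mathbb{Z}_{\geq 0}$. For a subset $S\subseteq\mathbb{Z}^n$ and an integer $p\ge 0$, the $p$-th distinct sum set of $S$ is $\mathcal{D}_pS:=\{\sum_{m\in T}m \mid T\subseteq S,\ \#T=p\}$, with $\mathcal{D}_0S=\{0\}$ (the origin). A lattice point is a point with integer coordinates. $\operatorname{conv}$ denotes the convex hull. *)

theory Defs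
  imports "HOL-Analysis.Analysis"
begin

text \<open>Throughout, \<open>\<int>\<^sup>n\<close> is the set of vectors of \<open>\<real>\<^sup>n\<close> all of whose coordinates are integers, so that
  lattice points and convex hulls live in the same space and no embedding is needed.\<close>

definition int_points :: "(real ^ 'n) set" where
  "int_points = {x. \<forall>i. x $ i \<in> \<int>}"

definition nat_points :: "(real ^ 'n) set" where
  "nat_points = {x. \<forall>i. x $ i \<in> \<nat>}"

text \<open>The requirement \<^term>\<open>finite T\<close> is needed because \<^const>\<open>card\<close> is 0 on infinite sets.\<close>

definition distinct_sumset :: "nat \<Rightarrow> 'a::comm_monoid_add set \<Rightarrow> 'a set" where
  "distinct_sumset p S = {\<Sum>m\<in>T. m | T. T \<subseteq> S \<and> finite T \<and> card T = p}"

lemma distinct_sumset_0: "distinct_sumset 0 S = {0}"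
proof -
  have "T \<subseteq> S \<and> finite T \<and> card T = 0 \<longleftrightarrow> T = {}" for T
    by auto
  then show ?thesis
    by (simp add: distinct_sumset_def)
qed

definition corner_cut_polyhedron :: "nat \<Rightarrow> (real ^ 'n) set" where
  "corner_cut_polyhedron d = convex hull (distinct_sumset d nat_points)"

end

theory Submission
  imports Defs
begin

text \<open>
  Let \<open>A\<close> be the set of sums of \<open>d > 0\<close> distinct points of \<open>\<nat>\<^sup>2\<close>. It is closed under adding
  points of \<open>\<nat>\<^sup>2\<close>, so it is the region on and above the graph of the antitone function
  \<open>f x = min {y. (x, y) \<in> A}\<close>. This \<open>f\<close> need not be convex, so lattice points between the lower
  hull of the graph and the graph itself have to be excluded.

  Let \<open>(s, t)\<close> be a lattice point of the hull, with \<open>f s > 0\<close> as otherwise \<open>(s, t) \<in> A\<close>.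
  Some edge of the lower hull of the graph of \<open>f\<close> lies over the interval from \<open>s\<close> to \<open>s + 1\<close> (lemma \<open>lower_hull_edge\<close>); let
  \<open>(a, b)\<close> be its primitive integer normal, so that \<open>w (x, y) = a x + b y\<close> attains its minimum
  over \<open>A\<close> exactly on the line of the edge. Let \<open>q\<close> be the rightmost point of \<open>A\<close> on this line with
  abscissa at most \<open>s\<close>, and write \<open>q\<close> as the sum of a \<open>d\<close>-element set \<open>T\<close>. Since there are points of
  \<open>A\<close> on the line to the right of \<open>q\<close>, comparing \<open>T\<close> with the summands of such a point shows that
  some \<open>m \<in> T\<close> can be moved by the primitive edge vector \<open>(b, -a)\<close> to a point of \<open>\<nat>\<^sup>2\<close> outside \<open>T\<close>
  (lemma \<open>minimiser_has_step\<close>). Two things follow.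

  First, \<open>q + (b, -a) \<in> A\<close>, so by the choice of \<open>q\<close> the target is \<open>(s, t) = q + (i, -j)\<close> with
  \<open>0 \<le> i < b\<close>. Secondly, if \<open>j > 0\<close>, then the same \<open>m\<close> can be moved by \<open>(i, -j)\<close> alone: here \<open>j < a\<close>,
  so \<open>m + (i, -j)\<close> is still in \<open>\<nat>\<^sup>2\<close>. Its weight exceeds that of \<open>m + (b, -a)\<close> by
  \<open>a i - b j\<close>, which is nonnegative because \<open>(s, t)\<close> is in the hull, and nonzero because
  \<open>0 < i < b\<close> and \<open>a\<close>, \<open>b\<close> are coprime. So it is not in \<open>T\<close>, as otherwise exchanging the two
  would push the weight of \<open>T\<close> below the minimum. This exhibits \<open>(s, t)\<close> as an element of \<open>A\<close>. If \<open>j \<le> 0\<close>, then \<open>(s, t)\<close> lies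
  above \<open>q\<close> and is in \<open>A\<close> anyway.

  The convex hull enters only through the fact that it satisfies every linear inequality that is
  valid on \<open>A\<close>.
\<close>

section \<open>Sums of distinct points of the quadrant\<close>

text \<open>Points of the quadrant are pairs of natural numbers here, so that the weights \<open>a x + b y\<close>
  that are minimised below are natural numbers.\<close>

definition sum_of_distinct :: "nat \<Rightarrow> nat \<Rightarrow> nat \<Rightarrow> bool" where
  "sum_of_distinct d x y \<longleftrightarrow>
     (\<exists>T :: (nat \<times> nat) set. finite T \<and> card T = d \<and> sum fst T = x \<and> sum snd T = y)"

lemma sum_exchange:
  fixes g :: "'a \<Rightarrow> nat"
  assumes "finite T" "m \<in> T" "n \<notin> T"
  shows "sum g (insert n (T - {m})) + g m = sum g T + g n"
  using assms by (simp add: sum.remove[of T m])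

lemma card_exchange:
  assumes "finite T" "m \<in> T" "n \<notin> T"
  shows "card (insert n (T - {m})) = card T"
  using assms by (metis Diff_iff card.remove card_insert_disjoint finite_Diff)

lemma sum_of_distinct_exchange:
  assumes "finite T" "m \<in> T" "n \<notin> T"
    and "x + fst m = sum fst T + fst n" "y + snd m = sum snd T + snd n"
  shows "sum_of_distinct (card T) x y"
  unfolding sum_of_distinct_def
  using assms sum_exchange[OF assms(1-3), of fst] sum_exchange[OF assms(1-3), of snd]
    card_exchange[OF assms(1-3)]
  by (intro exI[of _ "insert n (T - {m})"]) auto

lemma sum_of_distinct_swap:
  assumes "sum_of_distinct d x y"
  shows "sum_of_distinct d y x"
proof -
  obtain T :: "(nat \<times> nat) set"
    where "finite T" "card T = d" "sum fst T = x" "sum snd T = y"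
    using assms unfolding sum_of_distinct_def by blast
  then show ?thesis
    unfolding sum_of_distinct_def
    by (intro exI[of _ "prod.swap ` T"]) (auto simp: card_image sum.reindex comp_def)
qed

text \<open>A summand with the largest abscissa can be pushed one step to the right without meeting
  another summand.\<close>

lemma sum_of_distinct_Suc_fst:
  assumes "sum_of_distinct d x y" "d > 0"
  shows "sum_of_distinct d (Suc x) y"
proof -
  obtain T :: "(nat \<times> nat) set"
    where T: "finite T" "card T = d" "sum fst T = x" "sum snd T = y"
    using assms unfolding sum_of_distinct_def by blast
  have "T \<noteq> {}" using T assms(2) by auto
  then obtain m where m: "m \<in> T" "\<forall>n\<in>T. fst n \<le> fst m"
    using obtains_MAX[OF T(1), of fst] by (metis Max_ge finite_imageI image_eqI T(1))
  then have "(Suc (fst m), snd m) \<notin> T" by force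
  then show ?thesis
    using sum_of_distinct_exchange[OF T(1) m(1), of "(Suc (fst m), snd m)" "Suc x" y] T by simp
qed

lemma sum_of_distinct_mono:
  assumes "sum_of_distinct d x y" "d > 0" "x \<le> x'" "y \<le> y'"
  shows "sum_of_distinct d x' y'"
proof -
  have *: "sum_of_distinct d x' y" if "sum_of_distinct d x y" "x \<le> x'" for x x' y
    using that(2,1) by (induction rule: dec_induct) (auto intro: sum_of_distinct_Suc_fst assms(2))
  show ?thesis
    using assms * sum_of_distinct_swap by metis
qed

lemma sum_of_distinct_on_axis: "sum_of_distinct d (\<Sum>{..<d}) 0"
  unfolding sum_of_distinct_def
  by (intro exI[of _ "(\<lambda>i. (i, 0)) ` {..<d}"])
    (auto simp: card_image inj_on_def sum.reindex comp_def)

section \<open>Sets of minimal weight\<close>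

lemma sum_less_imp_ex_less:
  fixes g :: "'a \<Rightarrow> nat"
  assumes "finite A" "finite B" "card A = card B" "sum g A < sum g B"
  shows "\<exists>m\<in>A. \<exists>n\<in>B. g m < g n"
proof (rule ccontr)
  assume "\<not> ?thesis"
  then have le: "g n \<le> g m" if "m \<in> A" "n \<in> B" for m n
    using that by (auto simp: not_less)
  obtain h where h: "bij_betw h B A"
    using assms finite_same_card_bij by metis
  have "sum g B \<le> (\<Sum>n\<in>B. g (h n))"
    using h le by (intro sum_mono) (auto dest: bij_betwE)
  also have "\<dots> = sum g A" by (rule sum.reindex_bij_betw[OF h])
  finally show False using assms by simp
qed

text \<open>In a set of minimal weight no summand is heavier than an unused point, since exchanging the
  two would lower the total.\<close>

lemma minimiser_exchange:
  fixes T :: "(nat \<times> nat) set"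
  assumes min: "\<And>x y. sum_of_distinct (card T) x y \<Longrightarrow> a * sum fst T + b * sum snd T \<le> a * x + b * y"
    and "finite T" "m \<in> T" "n \<notin> T"
  shows "a * fst m + b * snd m \<le> a * fst n + b * snd n"
proof -
  let ?T = "insert n (T - {m})"
  have "sum_of_distinct (card T) (sum fst ?T) (sum snd ?T)"
    using assms(2-) by (intro sum_of_distinct_exchange[of T m n] sum_exchange) auto
  then have "a * sum fst T + b * sum snd T \<le> a * sum fst ?T + b * sum snd ?T" by (rule min)
  moreover have "a * sum fst ?T + a * fst m = a * sum fst T + a * fst n"
    using sum_exchange[OF assms(2-), of fst] by (metis distrib_left)
  moreover have "b * sum snd ?T + b * snd m = b * sum snd T + b * snd n"
    using sum_exchange[OF assms(2-), of snd] by (metis distrib_left)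
  ultimately show ?thesis by linarith
qed

text \<open>Two sets \<open>T\<close> and \<open>V\<close> of minimal weight differ only in points of equal weight, and as \<open>V\<close> has
  the sum further to the right, some \<open>n \<in> V - T\<close> is to the right of some \<open>m \<in> T - V\<close>. By
  coprimality \<open>n\<close> is \<open>m\<close> plus a multiple of \<open>(b, -a)\<close>, and walking from \<open>m\<close> to \<open>n\<close> in steps of
  \<open>(b, -a)\<close> leaves \<open>T\<close> at some point. The step that leaves \<open>T\<close> goes from \<open>(x, y + a)\<close> to
  \<open>(x + b, y)\<close>; this form records that its target has a nonnegative ordinate.\<close>

lemma minimiser_has_step:
  fixes T V :: "(nat \<times> nat) set"
  assumes ab: "a > 0" "b > 0" "coprime a b"
    and fin: "finite T" "finite V" and card: "card T = d" "card V = d"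
    and minT: "\<And>x y. sum_of_distinct d x y \<Longrightarrow> a * sum fst T + b * sum snd T \<le> a * x + b * y"
    and minV: "\<And>x y. sum_of_distinct d x y \<Longrightarrow> a * sum fst V + b * sum snd V \<le> a * x + b * y"
    and less: "sum fst T < sum fst V"
  obtains x y where "(x, y + a) \<in> T" "(x + b, y) \<notin> T"
proof -
  have "card (T - V) = card (V - T)"
    using card fin by (metis card_le_sym_Diff order_antisym le_refl)
  moreover have "sum fst (T - V) < sum fst (V - T)"
  proof -
    have "sum fst T = sum fst (T - V) + sum fst (T \<inter> V)"
      "sum fst V = sum fst (V - T) + sum fst (T \<inter> V)"
      using fin by (metis Int_commute add.commute sum.Int_Diff)+
    then show ?thesis using less by simp
  qed
  ultimately obtain m n where mn: "m \<in> T" "m \<notin> V" "n \<in> V" "n \<notin> T" "fst m < fst n"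
    using sum_less_imp_ex_less[of "T - V" "V - T" fst] fin by blast
  have eq: "a * fst m + b * snd m = a * fst n + b * snd n"
    using minimiser_exchange[of T a b m n] minimiser_exchange[of V a b n m] minT minV mn fin card
    by (intro order_antisym) auto
  have "snd n < snd m"
  proof (rule ccontr)
    assume "\<not> snd n < snd m"
    then have "b * snd m \<le> b * snd n" by simp
    moreover have "a * fst m < a * fst n" using mn ab by simp
    ultimately show False using eq by linarith
  qed
  then have eq': "a * (fst n - fst m) = b * (snd m - snd n)"
    using eq mn by (simp add: diff_mult_distrib2)
  then have "b dvd fst n - fst m"
    using ab by (metis coprime_commute coprime_dvd_mult_right_iff dvd_triv_left)
  then obtain r where r: "fst n - fst m = b * r" by (elim dvdE)
  then have r': "snd m - snd n = a * r" using eq' ab by simp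
  \<comment> \<open>the \<open>k\<close>-th point of the walk, written relative to the lower end to avoid truncated subtraction\<close>
  let ?P = "\<lambda>k. (fst m + b * k, snd n + a * (r - k))"
  have P0: "?P 0 \<in> T" 
    using mn r' \<open>snd n < snd m\<close> by (metis add_0_right diff_zero le_add_diff_inverse less_imp_le_nat mult_0_right prod.collapse)
  have Pr: "?P r \<notin> T" using mn r by (metis add_0_right diff_self_eq_0 le_add_diff_inverse less_imp_le_nat mult_0_right prod.collapse)
  define k where "k = (LEAST k. ?P k \<notin> T)"
  have k: "?P k \<notin> T" "k \<le> r" unfolding k_def using Pr by (rule LeastI, rule Least_le)
  with P0 have "k \<noteq> 0" by metis
  then obtain l where l: "k = Suc l" using not0_implies_Suc by blast
  have "?P l \<in> T" using not_less_Least[of l "\<lambda>k. ?P k \<notin> T"] l unfolding k_def by auto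
  moreover have "r - l = Suc (r - k)" using k l by simp
  ultimately show thesis
    using that[of "fst m + b * l" "snd n + a * (r - k)"] k l by (simp add: algebra_simps)
qed

section \<open>Edges of the lower hull of a decreasing function\<close>

text \<open>Among the chords of the graph that join an abscissa \<open>u \<le> s\<close> to an abscissa \<open>v > s\<close>, one that
  is lowest at \<open>s + 1/2\<close> carries an edge of the lower hull: a point of the graph below it, on either
  side, could replace the endpoint on that side and give a lower chord. The half-integer is not an
  abscissa of the graph, so every point is on one of the two sides and no vertex of the hull
  needs special treatment.\<close>

lemma lower_hull_edge:
  fixes f :: "nat \<Rightarrow> nat"
  assumes anti: "antimono f" and zero: "f N = 0" and pos: "f s > 0"
  obtains a b u v where "a > 0" "b > 0" "coprime a b" "u \<le> s" "s < v"
    "a * u + b * f u = a * v + b * f v"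
    "\<And>x. a * u + b * f u \<le> a * x + b * f x"
proof -
  have sN: "s < N"
    using anti zero pos by (metis antimonoD leD le_zero_eq not_less)
  \<comment> \<open>twice the height of the chord from \<open>u\<close> to \<open>v\<close> at \<open>s + 1/2\<close>\<close>
  define g where "g = (\<lambda>(u, v). (real (f u) * (2 * real v - 2 * real s - 1)
      + real (f v) * (2 * real s + 1 - 2 * real u)) / (real v - real u))"
  let ?P = "{..s} \<times> {s<..N}"
  have "finite ?P" "?P \<noteq> {}" using sN by auto
  then obtain z where z: "z \<in> ?P" "\<And>w. w \<in> ?P \<Longrightarrow> g z \<le> g w"
    by (metis arg_min_if_finite(1) arg_min_least)
  obtain u v where uv': "z = (u, v)" by force
  with z have uv: "u \<le> s" "s < v" "v \<le> N" by auto
  define A B where "A = real (f u) - real (f v)" and "B = real v - real u"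
  have B: "B > 0" using uv by (simp add: B_def)
  have on: "A * u + B * f u = A * v + B * f v"
    by (simp add: A_def B_def algebra_simps)
  have below: "A * u + B * f u \<le> A * x + B * f x" if "x \<le> N" for x
  proof (cases "x \<le> s")
    case True
    have e: "g (y, v) = 2 * real (f v)
        + (2 * real v - 2 * real s - 1) * ((real (f y) - real (f v)) / (real v - real y))"
      if "y \<le> s" for y
      using uv that by (simp add: g_def field_simps)
    have "g (u, v) \<le> g (x, v)" using z(2)[of "(x, v)"] True uv uv' by auto
    then have "(2 * real v - 2 * real s - 1) * (A / B)
        \<le> (2 * real v - 2 * real s - 1) * ((real (f x) - real (f v)) / (real v - real x))"
      unfolding e[OF uv(1)] e[OF True] A_def B_def by simp
    moreover have "0 < 2 * real v - 2 * real s - 1" using uv by linarith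
    ultimately have "A / B \<le> (real (f x) - real (f v)) / (real v - real x)"
      by (simp only: mult_le_cancel_left_pos)
    then have "A * (real v - real x) \<le> (real (f x) - real (f v)) * B"
      using B True uv by (simp add: divide_simps mult.commute split: if_splits)
    then show ?thesis unfolding on by (simp add: algebra_simps)
  next
    case False
    have e: "g (u, y) = 2 * real (f u)
        + (2 * real s + 1 - 2 * real u) * ((real (f y) - real (f u)) / (real y - real u))"
      if "y > s" for y
      using uv that by (simp add: g_def field_simps)
    have "g (u, v) \<le> g (u, x)" using z(2)[of "(u, x)"] False uv uv' that by auto
    then have "(2 * real s + 1 - 2 * real u) * (- A / B)
        \<le> (2 * real s + 1 - 2 * real u) * ((real (f x) - real (f u)) / (real x - real u))"
      using e[of v] e[of x] uv False by (simp add: A_def B_def)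
    moreover have "0 < 2 * real s + 1 - 2 * real u" using uv by linarith
    ultimately have "- A / B \<le> (real (f x) - real (f u)) / (real x - real u)"
      by (simp only: mult_le_cancel_left_pos)
    then have "- A * (real x - real u) \<le> (real (f x) - real (f u)) * B"
      using B False uv by (simp add: divide_simps mult.commute split: if_splits)
    then show ?thesis by (simp add: algebra_simps)
  qed
  have fu: "f u > 0" using antimonoD[OF anti uv(1)] pos by simp
  \<comment> \<open>a line through \<open>(u, f u)\<close> that does not descend would pass above \<open>(N, f N) = (N, 0)\<close>\<close>
  have A: "A > 0"
  proof (rule ccontr)
    assume "\<not> A > 0"
    then have "A * (real N - real u) \<le> 0" using uv by (simp add: mult_nonpos_nonneg)
    moreover have "B * real (f u) > 0" using B fu by simp
    ultimately show False using below[of N] zero by (simp add: algebra_simps)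
  qed
  define a' b' where "a' = f u - f v" and "b' = v - u"
  have A': "A = real a'" "B = real b'" using A B by (auto simp: A_def B_def a'_def b'_def)
  have pos': "a' > 0" "b' > 0" using A B A' by auto
  have below': "a' * u + b' * f u \<le> a' * x + b' * f x" for x
  proof (cases "x \<le> N")
    case True
    then have "real (a' * u + b' * f u) \<le> real (a' * x + b' * f x)" using below A' by simp
    then show ?thesis by linarith
  next
    case False
    have "real (a' * u + b' * f u) \<le> real (a' * N + b' * f N)" using below[of N] A' by simp
    then have "a' * u + b' * f u \<le> a' * N" using zero by (simp only: of_nat_le_iff)
    also have "\<dots> \<le> a' * x + b' * f x" using False by (simp add: trans_le_add1)
    finally show ?thesis .
  qed
  have on': "a' * u + b' * f u = a' * v + b' * f v"
  proof -
    have "real (a' * u + b' * f u) = real (a' * v + b' * f v)" using on A' by simp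
    then show ?thesis by linarith
  qed
  obtain a b where ab: "a' = a * gcd a' b'" "b' = b * gcd a' b'" "coprime a b"
    using gcd_coprime_exists[of a' b'] pos' by auto
  define c where "c = gcd a' b'"
  have c: "a' = c * a" "b' = c * b" "c > 0" using ab pos' by (auto simp: c_def mult.commute)
  show thesis
  proof (rule that[of a b u v])
    show "a > 0" "b > 0" using pos' c by auto
    have s: "a' * x + b' * y = c * (a * x + b * y)" for x y by (simp add: c algebra_simps)
    show "a * u + b * f u = a * v + b * f v" using on' c(3) unfolding s by simp
    show "a * u + b * f u \<le> a * x + b * f x" for x using below'[of x] c(3) unfolding s by simp
  qed (use ab uv in auto)
qed

section \<open>Lattice points above the supporting lines\<close>

text \<open>This is the core of the argument: among the lattice points satisfying all valid inequalities
  with natural coefficients, none is missed. Unless \<open>(s, 0)\<close> is itself a sum, a single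
  inequality suffices, the one of the edge of the lower hull over the interval from \<open>s\<close> to \<open>s + 1\<close>.\<close>

lemma sum_of_distinct_if_above_supporting_lines:
  assumes d: "d > 0"
    and above: "\<And>a b c. (\<And>x y. sum_of_distinct d x y \<Longrightarrow> c \<le> a * x + b * y) \<Longrightarrow> c \<le> a * s + b * t"
  shows "sum_of_distinct d s t"
proof -
  define f where "f x = (LEAST y. sum_of_distinct d x y)" for x
  have "sum_of_distinct d x (\<Sum>{..<d})" for x
    using sum_of_distinct_mono[OF sum_of_distinct_swap[OF sum_of_distinct_on_axis] d] by simp
  then have f: "sum_of_distinct d x (f x)" for x
    unfolding f_def by (rule LeastI)
  have f_le: "f x \<le> y" if "sum_of_distinct d x y" for x y
    unfolding f_def using that by (rule Least_le)
  have "antimono f"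
    by (rule antimonoI, rule f_le, rule sum_of_distinct_mono[OF f d]) auto
  moreover have "f (\<Sum>{..<d}) = 0"
    using f_le[OF sum_of_distinct_on_axis] by simp
  moreover have ?thesis if "f s = 0"
    using sum_of_distinct_mono[OF f[of s] d, of s t] that by simp
  moreover have ?thesis if anti: "antimono f" and zero: "f (\<Sum>{..<d}) = 0" and fs: "f s > 0"
  proof -
    obtain a b u0 v where ab: "a > 0" "b > 0" "coprime a b" and uv: "u0 \<le> s" "s < v"
      and on0: "a * u0 + b * f u0 = a * v + b * f v"
      and below0: "\<And>x. a * u0 + b * f u0 \<le> a * x + b * f x"
      using lower_hull_edge[OF anti zero fs] by metis
    define c where "c = a * u0 + b * f u0"
    have below: "c \<le> a * x + b * y" if "sum_of_distinct d x y" for x y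
    proof -
      have "b * f x \<le> b * y" using f_le[OF that] by simp
      with below0[of x] show ?thesis unfolding c_def by linarith
    qed
    \<comment> \<open>\<open>(u, f u)\<close> is the last point of the edge line that is attained at or before \<open>s\<close>\<close>
    define U where "U = {x. x \<le> s \<and> a * x + b * f x = c}"
    have U: "finite U" "U \<noteq> {}" using uv by (auto simp: U_def c_def)
    define u where "u = Max U"
    have u: "u \<le> s" "a * u + b * f u = c" using Max_in[OF U] by (auto simp: u_def U_def)
    have u_max: "x \<le> u" if "x \<le> s" "a * x + b * f x = c" for x
      using that U by (auto simp: u_def U_def)
    obtain T where T: "finite T" "card T = d" "sum fst T = u" "sum snd T = f u"
      using f[of u] unfolding sum_of_distinct_def by auto
    obtain V where V: "finite V" "card V = d" "sum fst V = v" "sum snd V = f v"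
      using f[of v] unfolding sum_of_distinct_def by auto
    have minT: "a * sum fst T + b * sum snd T \<le> a * x + b * y" if "sum_of_distinct d x y" for x y
      using below[OF that] u T by simp
    have minV: "a * sum fst V + b * sum snd V \<le> a * x + b * y" if "sum_of_distinct d x y" for x y
      using below[OF that] on0 V by (simp add: c_def)
    obtain x y where xy: "(x, y + a) \<in> T" "(x + b, y) \<notin> T"
      using minimiser_has_step[OF ab T(1) V(1) T(2) V(2) minT minV] u uv T V by auto
    have "y + a \<le> f u" using T(1,4) xy(1) member_le_sum[of "(x, y + a)" T snd] by simp
    then have "a \<le> f u" by simp
    \<comment> \<open>the next point of the edge line is attained as well, so it must lie beyond \<open>s\<close>\<close>
    have "sum_of_distinct d (u + b) (f u - a)"
      using sum_of_distinct_exchange[OF T(1) xy, of "u + b" "f u - a"] T \<open>a \<le> f u\<close> by simp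
    then have "f (u + b) \<le> f u - a" by (rule f_le)
    then have "b * f (u + b) \<le> b * (f u - a)" by simp
    then have "a * (u + b) + b * f (u + b) \<le> a * (u + b) + b * (f u - a)" by simp
    also have "\<dots> = c"
    proof -
      obtain w where w: "f u = a + w" using \<open>a \<le> f u\<close> le_Suc_ex by blast
      show ?thesis unfolding u(2)[symmetric] w by (simp add: algebra_simps)
    qed
    finally have "a * (u + b) + b * f (u + b) = c" using below[OF f[of "u + b"]] by simp
    then have sb: "s < u + b" using u_max[of "u + b"] ab by (metis add_le_same_cancel1 leI le_zero_eq less_numeral_extra(3))
    have st: "c \<le> a * s + b * t" using above below by blast
    show ?thesis
    proof (cases "f u \<le> t")
      case True
      then show ?thesis using sum_of_distinct_mono[OF f[of u] d u(1)] by simp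
    next
      case False
      define i j where "i = s - u" and "j = f u - t"
      have ij: "s = u + i" "f u = t + j" "j > 0" "i < b" using False u sb by (auto simp: i_def j_def)
      have le: "b * j \<le> a * i" using st unfolding u(2)[symmetric] ij by (simp add: algebra_simps)
      have "i > 0" using le ij ab by (cases "i = 0") auto
      have ne: "b * j \<noteq> a * i"
      proof
        assume "b * j = a * i"
        then have "b dvd i"
          using ab by (metis coprime_commute coprime_dvd_mult_right_iff dvd_triv_left)
        then show False using ij \<open>i > 0\<close> by (auto dest: dvd_imp_le)
      qed
      have "j < a"
      proof (rule ccontr)
        assume "\<not> j < a"
        then have "b * a \<le> b * j" by simp
        also have "\<dots> \<le> a * i" by (rule le)
        also have "\<dots> < a * b" using ij ab by simp
        finally show False by (simp add: mult.commute)
      qed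
      \<comment> \<open>the summand \<open>(x, y + a)\<close> moved by \<open>(i, -j)\<close>; it is heavier than the unused point \<open>(x + b, y)\<close>\<close>
      let ?n = "(x + i, y + a - j)"
      have "?n \<notin> T"
      proof
        assume "?n \<in> T"
        then have "a * (x + i) + b * (y + a - j) \<le> a * (x + b) + b * y"
          using minimiser_exchange[of T a b ?n "(x + b, y)"] minT T xy by simp
        moreover obtain w where w: "a = j + w" using \<open>j < a\<close> le_Suc_ex less_imp_le by blast
        moreover have "y + a - j = y + w" using w by simp
        ultimately have "a * x + a * i + b * y + b * w \<le> a * x + a * b + b * y" by (simp only: distrib_left)
        moreover have "a * b = b * j + b * w" using w by (simp add: algebra_simps)
        ultimately show False using le ne by linarith
      qed
      then show ?thesis
        using sum_of_distinct_exchange[OF T(1) xy(1), of ?n s t] T ij \<open>j < a\<close> by simp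
    qed
  qed
  ultimately show ?thesis by blast
qed

section \<open>Lattice points of the plane\<close>

definition point :: "nat \<times> nat \<Rightarrow> real ^ 2" where
  "point p = vector [real (fst p), real (snd p)]"

lemma point_nth [simp]: "point p $ 1 = real (fst p)" "point p $ 2 = real (snd p)"
  by (simp_all add: point_def)

lemma range_point: "range point = nat_points"
proof -
  have "\<exists>p. z = point p" if "z \<in> nat_points" for z
    using that by (auto simp: nat_points_def Nats_def forall_2 vec_eq_iff)
  then show ?thesis by (auto simp: nat_points_def forall_2)
qed

lemma inj_point: "inj point"
  by (auto simp: inj_on_def vec_eq_iff forall_2 prod_eq_iff)

lemma distinct_sumset_nat_points:
  "distinct_sumset d nat_points = {point (x, y) | x y. sum_of_distinct d x y}"
proof -
  have sum: "(\<Sum>m\<in>point ` T. m) = point (sum fst T, sum snd T)" for T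
    by (simp add: sum.reindex inj_on_subset[OF inj_point] vec_eq_iff forall_2)
  have "distinct_sumset d nat_points
      = {\<Sum>m\<in>point ` T. m | T. finite T \<and> card T = d}"
    unfolding distinct_sumset_def range_point[symmetric]
    by (force simp: subset_image_iff card_image finite_image_iff inj_on_subset[OF inj_point])
  also have "\<dots> = {point (x, y) | x y. sum_of_distinct d x y}"
    unfolding sum sum_of_distinct_def by blast
  finally show ?thesis .
qed

lemma corner_cut_polyhedron_halfspace:
  fixes p :: "real ^ 2"
  assumes "p \<in> corner_cut_polyhedron d"
    and "\<And>x y. sum_of_distinct d x y \<Longrightarrow> c \<le> a * real x + b * real y"
  shows "c \<le> a * p $ 1 + b * p $ 2"
proof -
  have "convex {z :: real ^ 2. c \<le> vector [a, b] \<bullet> z}"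
    using convex_halfspace_ge[of c "vector [a, b] :: real ^ 2"] by simp
  then have "(corner_cut_polyhedron d :: (real ^ 2) set) \<subseteq> {z :: real ^ 2. c \<le> vector [a, b] \<bullet> z}"
    unfolding corner_cut_polyhedron_def using assms(2)
    by (intro hull_minimal) (auto simp: distinct_sumset_nat_points inner_vec_def sum_2)
  then show ?thesis using assms(1) by (auto simp: inner_vec_def sum_2)
qed

theorem corollary5:
  fixes d :: nat
  shows "(corner_cut_polyhedron d :: (real ^ 2) set) \<inter> int_points
           \<subseteq> distinct_sumset d nat_points"
proof
  fix p :: "real ^ 2"
  assume p: "p \<in> corner_cut_polyhedron d \<inter> int_points"
  show "p \<in> distinct_sumset d nat_points"
  proof (cases "d = 0")
    case True
    then show ?thesis using p by (simp add: corner_cut_polyhedron_def distinct_sumset_0)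
  next
    case False
    have "0 \<le> p $ 1" "0 \<le> p $ 2"
      using corner_cut_polyhedron_halfspace[of p d 0 1 0] corner_cut_polyhedron_halfspace[of p d 0 0 1] p
      by auto
    with p have "p \<in> nat_points"
      by (auto simp: int_points_def nat_points_def forall_2 Nats_altdef2)
    then obtain s t where st: "p = point (s, t)"
      by (auto simp: range_point[symmetric])
    have "sum_of_distinct d s t"
    proof (rule sum_of_distinct_if_above_supporting_lines)
      fix a b c :: nat
      assume le: "\<And>x y. sum_of_distinct d x y \<Longrightarrow> c \<le> a * x + b * y"
      have "real c \<le> real a * real x + real b * real y" if "sum_of_distinct d x y" for x y
        using le[OF that] by (metis of_nat_add of_nat_le_iff of_nat_mult)
      then have "real c \<le> real a * p $ 1 + real b * p $ 2"
        using p by (intro corner_cut_polyhedron_halfspace) auto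
      then show "c \<le> a * s + b * t"
        unfolding st by (simp flip: of_nat_add of_nat_mult)
    qed (use False in simp)
    then show ?thesis by (auto simp: st distinct_sumset_nat_points)
  qed
qed

end
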